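(* Let $D$ be a nonempty countable set and let $P,Q$ be proper upward monotone quantifiers on $D$. Then $P$ dominates $Q$ if and only if at least one of the following two equalities holds: $$P\cdot Q=P\boxtimes Q,\qquad Q^d\cdot P^d=Q^d\boxtimes P^d.$$
   Context: A (unary) quantifier on a nonempty set $D$ is a family $Q\subseteq\mathcal P(D)$. It is upward monotone if $A\in Q$ and $A\subseteq B\subseteq D$ imply $B\in Q$; it is proper if $\varnothing\notin Q$ and $D\in Q$. For $R\subseteq D^2$ put $R_x=\{y\in D:(x,y)\in R\}$ and $R^{-1}=\{(y,x):(x,y)\in R\}$. The iteration is $P\cdot Q=\{R\subseteq D^2:\{x\in D:R_x\in Q\}\in P\}$. $P$ dominates $Q$ if for every $R\subseteq D^2$, $R\in P\cdot Q$ implies $R^{-1}\in Q\cdot P$. The branching product is $P\boxtimes Q=\{R\subseteq D^2:\exists A\in P\ \exists B\in Q\ (A\times B\subseteq R)\}$. The dual of $Q$ is $Q^d=\{A\subseteq D:D\setminus A\notin Q\}$. *)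

theory Defs
  imports "HOL-Library.Countable_Set"
begin

definition quantifier_on :: "'a set \<Rightarrow> 'a set set \<Rightarrow> bool" where
  "quantifier_on D Q \<longleftrightarrow> Q \<subseteq> Pow D"

definition upward_monotone_on :: "'a set \<Rightarrow> 'a set set \<Rightarrow> bool" where
  "upward_monotone_on D Q \<longleftrightarrow> (\<forall>A B. A \<in> Q \<longrightarrow> A \<subseteq> B \<longrightarrow> B \<subseteq> D \<longrightarrow> B \<in> Q)"

definition proper_on :: "'a set \<Rightarrow> 'a set set \<Rightarrow> bool" where
  "proper_on D Q \<longleftrightarrow> {} \<notin> Q \<and> D \<in> Q"

definition iteration :: "'a set \<Rightarrow> 'a set set \<Rightarrow> 'a set set \<Rightarrow> ('a \<times> 'a) set set" where
  "iteration D P Q = {R. R \<subseteq> D \<times> D \<and> {x \<in> D. {y \<in> D. (x, y) \<in> R} \<in> Q} \<in> P}"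

definition dominates_on :: "'a set \<Rightarrow> 'a set set \<Rightarrow> 'a set set \<Rightarrow> bool" where
  "dominates_on D P Q \<longleftrightarrow>
     (\<forall>R. R \<subseteq> D \<times> D \<longrightarrow> R \<in> iteration D P Q \<longrightarrow> R\<inverse> \<in> iteration D Q P)"

definition branching :: "'a set \<Rightarrow> 'a set set \<Rightarrow> 'a set set \<Rightarrow> ('a \<times> 'a) set set" where
  "branching D P Q = {R. R \<subseteq> D \<times> D \<and> (\<exists>A\<in>P. \<exists>B\<in>Q. A \<times> B \<subseteq> R)}"

definition dual_on :: "'a set \<Rightarrow> 'a set set \<Rightarrow> 'a set set" where
  "dual_on D Q = {A. A \<subseteq> D \<and> D - A \<notin> Q}"

end

theory Submission
  imports Defs
begin

text \<open>
  A member of the branching product contains a rectangle, and rectangles can be transposed; so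
  either equality yields domination, the second one because domination of \<open>Q\<close> by \<open>P\<close> is the same
  as domination of \<open>P\<^sup>d\<close> by \<open>Q\<^sup>d\<close> (complement the relations).

  For the converse, the key observation is that domination forces \<open>Q\<close> or \<open>P\<^sup>d\<close> to be closed
  under binary intersections: two members of \<open>Q\<close> and two members of \<open>P\<^sup>d\<close> with bad intersections
  combine to a union of two rectangles that refutes domination
  (\<open>dominates_imp_inter_closed\<close>). By duality it suffices to treat the case of \<open>Q\<close>, in which \<open>Q\<close>
  is a filter. Let \<open>R\<close> have \<open>Q\<close>-large rows over \<open>A \<in> P\<close>. If some finite subset of \<open>A\<close> is in
  \<open>P\<close>, the intersection of its finitely many rows gives a rectangle in \<open>R\<close>. Otherwise
  countability lets one enumerate \<open>A\<close> and replace the rows by their decreasing partial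
  intersections, which are still in \<open>Q\<close>. Now a point \<open>y\<close> outside the intersection of all rows has
  a finite column, which is not in \<open>P\<close>; so domination says precisely that the intersection of all
  rows is in \<open>Q\<close>, and the rectangle over the whole of \<open>A\<close> is as required
  (\<open>iteration_eq_branching_if_inter_closed\<close>).
\<close>

definition proper_monotone :: "'a set \<Rightarrow> 'a set set \<Rightarrow> bool" where
  "proper_monotone D Q \<longleftrightarrow> quantifier_on D Q \<and> upward_monotone_on D Q \<and> proper_on D Q"

definition inter_closed :: "'a set set \<Rightarrow> bool" where
  "inter_closed Q \<longleftrightarrow> (\<forall>A\<in>Q. \<forall>B\<in>Q. A \<inter> B \<in> Q)"

lemma proper_monotone_subset: "proper_monotone D Q \<Longrightarrow> A \<in> Q \<Longrightarrow> A \<subseteq> D"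
  by (auto simp: proper_monotone_def quantifier_on_def)

lemma proper_monotone_mono:
  "proper_monotone D Q \<Longrightarrow> A \<in> Q \<Longrightarrow> A \<subseteq> B \<Longrightarrow> B \<subseteq> D \<Longrightarrow> B \<in> Q"
  by (auto simp: proper_monotone_def upward_monotone_on_def)

lemma proper_monotone_empty: "proper_monotone D Q \<Longrightarrow> {} \<notin> Q"
  by (auto simp: proper_monotone_def proper_on_def)

lemma proper_monotone_space: "proper_monotone D Q \<Longrightarrow> D \<in> Q"
  by (auto simp: proper_monotone_def proper_on_def)

lemma proper_monotone_dual:
  assumes "proper_monotone D Q"
  shows "proper_monotone D (dual_on D Q)"
proof -
  have "B \<in> dual_on D Q" if "A \<in> dual_on D Q" "A \<subseteq> B" "B \<subseteq> D" for A B
    using that proper_monotone_mono[OF assms, of "D - B" "D - A"] by (auto simp: dual_on_def)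
  then show ?thesis
    using proper_monotone_empty[OF assms] proper_monotone_space[OF assms]
    unfolding proper_monotone_def quantifier_on_def upward_monotone_on_def proper_on_def
    by (auto simp: dual_on_def)
qed

lemma dual_dual:
  assumes "quantifier_on D Q"
  shows "dual_on D (dual_on D Q) = Q"
  using assms by (auto simp: dual_on_def quantifier_on_def double_diff)

section \<open>Branching products\<close>

lemma branching_subset_iteration:
  assumes P: "proper_monotone D P" and Q: "proper_monotone D Q"
  shows "branching D P Q \<subseteq> iteration D P Q"
proof
  fix R assume "R \<in> branching D P Q"
  then obtain A B where R: "R \<subseteq> D \<times> D" and AB: "A \<in> P" "B \<in> Q" "A \<times> B \<subseteq> R"
    by (auto simp: branching_def)
  have "{y \<in> D. (x, y) \<in> R} \<in> Q" if "x \<in> A" for x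
    using that AB proper_monotone_subset[OF Q AB(2)]
    by (intro proper_monotone_mono[OF Q AB(2)]) auto
  then have "{x \<in> D. {y \<in> D. (x, y) \<in> R} \<in> Q} \<in> P"
    using proper_monotone_subset[OF P AB(1)]
    by (intro proper_monotone_mono[OF P AB(1)]) auto
  with R show "R \<in> iteration D P Q"
    by (simp add: iteration_def)
qed

lemma converse_in_branching: "R \<in> branching D P Q \<Longrightarrow> R\<inverse> \<in> branching D Q P"
  unfolding branching_def by blast

lemma dominates_if_iteration_eq_branching:
  assumes "proper_monotone D P" "proper_monotone D Q"
    and "iteration D P Q = branching D P Q"
  shows "dominates_on D P Q"
  using assms converse_in_branching branching_subset_iteration
  unfolding dominates_on_def by blast

section \<open>Duality\<close>

lemma iteration_dual:
  assumes "R \<subseteq> D \<times> D"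
  shows "R \<in> iteration D (dual_on D P) (dual_on D Q) \<longleftrightarrow> D \<times> D - R \<notin> iteration D P Q"
proof -
  have row: "{y \<in> D. (x, y) \<in> D \<times> D - R} = D - {y \<in> D. (x, y) \<in> R}" if "x \<in> D" for x
    using that by auto
  have "D - {x \<in> D. {y \<in> D. (x, y) \<in> R} \<in> dual_on D Q}
      = {x \<in> D. {y \<in> D. (x, y) \<in> D \<times> D - R} \<in> Q}"
    using row by (auto simp: dual_on_def)
  then show ?thesis
    using assms by (auto simp: iteration_def dual_on_def[of D P])
qed

lemma dominates_dual:
  assumes "dominates_on D P Q"
  shows "dominates_on D (dual_on D Q) (dual_on D P)"
  unfolding dominates_on_def
proof (intro allI impI)
  fix R assume R: "R \<subseteq> D \<times> D" and it: "R \<in> iteration D (dual_on D Q) (dual_on D P)"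
  have conv: "(D \<times> D - R\<inverse>)\<inverse> = D \<times> D - R" "R\<inverse> \<subseteq> D \<times> D"
    using R by auto
  have "D \<times> D - R \<notin> iteration D Q P"
    using it R iteration_dual by blast
  then have "D \<times> D - R\<inverse> \<notin> iteration D P Q"
    using assms conv(1) unfolding dominates_on_def by (metis Diff_subset)
  then show "R\<inverse> \<in> iteration D (dual_on D P) (dual_on D Q)"
    using conv(2) iteration_dual by blast
qed

lemma dominates_dual_iff:
  assumes "quantifier_on D P" "quantifier_on D Q"
  shows "dominates_on D (dual_on D Q) (dual_on D P) \<longleftrightarrow> dominates_on D P Q"
  using dominates_dual[of D P Q] dominates_dual[of D "dual_on D Q" "dual_on D P"] assms
  by (auto simp: dual_dual)

section \<open>Closure under intersections\<close>

text \<open>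
  If both closure properties fail, choose \<open>B\<^sub>1, B\<^sub>2 \<in> Q\<close> with \<open>B\<^sub>1 \<inter> B\<^sub>2 \<notin> Q\<close> and, passing to
  complements of members of \<open>P\<^sup>d\<close>, sets \<open>A\<^sub>1, A\<^sub>2 \<notin> P\<close> with \<open>A\<^sub>1 \<union> A\<^sub>2 \<in> P\<close>. In the relation
  \<open>A\<^sub>1 \<times> B\<^sub>1 \<union> A\<^sub>2 \<times> B\<^sub>2\<close> the rows over \<open>A\<^sub>1 \<union> A\<^sub>2\<close> are in \<open>Q\<close>, but a column is in \<open>P\<close> only
  over \<open>B\<^sub>1 \<inter> B\<^sub>2\<close>.
\<close>

lemma dominates_imp_inter_closed:
  assumes P: "proper_monotone D P" and Q: "proper_monotone D Q" and dom: "dominates_on D P Q"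
  shows "inter_closed Q \<or> inter_closed (dual_on D P)"
proof (rule ccontr)
  assume contra: "\<not> ?thesis"
  then obtain B1 B2 where B: "B1 \<in> Q" "B2 \<in> Q" "B1 \<inter> B2 \<notin> Q"
    by (auto simp: inter_closed_def)
  from contra obtain E1 E2 where E: "E1 \<in> dual_on D P" "E2 \<in> dual_on D P"
    "E1 \<inter> E2 \<notin> dual_on D P"
    by (auto simp: inter_closed_def)
  define A1 A2 where "A1 = D - E1" and "A2 = D - E2"
  have A: "A1 \<notin> P" "A2 \<notin> P" "A1 \<union> A2 \<in> P" "A1 \<subseteq> D" "A2 \<subseteq> D"
    using E unfolding A1_def A2_def by (auto simp: dual_on_def Diff_Int)
  have BD: "B1 \<subseteq> D" "B2 \<subseteq> D"
    using B Q proper_monotone_subset by blast+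
  define R where "R = A1 \<times> B1 \<union> A2 \<times> B2"
  have R: "R \<subseteq> D \<times> D"
    using A BD by (auto simp: R_def)
  have "{y \<in> D. (x, y) \<in> R} \<in> Q" if "x \<in> A1 \<union> A2" for x
  proof -
    from that consider "x \<in> A1" | "x \<in> A2" by blast
    then show ?thesis
    proof cases
      case 1
      then show ?thesis
        using BD by (intro proper_monotone_mono[OF Q B(1)]) (auto simp: R_def)
    next
      case 2
      then show ?thesis
        using BD by (intro proper_monotone_mono[OF Q B(2)]) (auto simp: R_def)
    qed
  qed
  then have "{x \<in> D. {y \<in> D. (x, y) \<in> R} \<in> Q} \<in> P"
    using A by (intro proper_monotone_mono[OF P A(3)]) auto
  then have "R\<inverse> \<in> iteration D Q P"
    using dom R by (auto simp: dominates_on_def iteration_def)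
  then have cols: "{y \<in> D. {x \<in> D. (x, y) \<in> R} \<in> P} \<in> Q"
    by (simp add: iteration_def)
  have "y \<in> B1 \<inter> B2" if "{x \<in> D. (x, y) \<in> R} \<in> P" for y
  proof (rule ccontr)
    assume "y \<notin> B1 \<inter> B2"
    then have "{x \<in> D. (x, y) \<in> R} \<subseteq> A1 \<or> {x \<in> D. (x, y) \<in> R} \<subseteq> A2"
      by (auto simp: R_def)
    then show False
      using proper_monotone_mono[OF P that] A by blast
  qed
  then have "B1 \<inter> B2 \<in> Q"
    using BD by (intro proper_monotone_mono[OF Q cols]) auto
  with B(3) show False ..
qed

lemma inter_closed_INT:
  assumes "inter_closed Q" "finite I" "I \<noteq> {}" "\<And>i. i \<in> I \<Longrightarrow> C i \<in> Q"
  shows "(\<Inter>i\<in>I. C i) \<in> Q"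
  using assms(2-4)
  by (induction I rule: finite_ne_induct) (use assms(1) in \<open>auto simp: inter_closed_def\<close>)

text \<open>
  For a filter \<open>Q\<close> and a set \<open>A \<in> P\<close> without finite subsets in \<open>P\<close>, domination acts as countable
  completeness: it is applied to the relation that enumerates \<open>A\<close> and relates each \<open>x \<in> A\<close> to the
  intersection of the sets \<open>C z\<close> with \<open>z\<close> not later than \<open>x\<close>.
\<close>

lemma dominates_imp_INT:
  assumes P: "proper_monotone D P" and Q: "proper_monotone D Q" and dom: "dominates_on D P Q"
    and "countable D" and cl: "inter_closed Q"
    and A: "A \<in> P" and no_fin: "\<And>F. F \<subseteq> A \<Longrightarrow> finite F \<Longrightarrow> F \<notin> P"
    and C: "\<And>x. x \<in> A \<Longrightarrow> C x \<in> Q"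
  shows "(\<Inter>x\<in>A. C x) \<in> Q"
proof -
  have AD: "A \<subseteq> D"
    using A P proper_monotone_subset by blast
  have CD: "C x \<subseteq> D" if "x \<in> A" for x
    using that C Q proper_monotone_subset by blast
  have A_ne: "A \<noteq> {}"
    using A P proper_monotone_empty by blast
  define f where "f = to_nat_on A"
  have f: "inj_on f A"
    using AD \<open>countable D\<close> countable_subset inj_on_to_nat_on unfolding f_def by blast
  define I where "I n = {z \<in> A. f z \<le> n}" for n
  have fin: "finite (I n)" for n
  proof (rule inj_on_finite)
    show "inj_on f (I n)"
      using f by (rule inj_on_subset) (auto simp: I_def)
    show "f ` I n \<subseteq> {..n}"
      by (auto simp: I_def)
  qed simp
  define R where "R = {(x, y). x \<in> A \<and> y \<in> (\<Inter>z\<in>I (f x). C z)}"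
  have self: "x \<in> I (f x)" if "x \<in> A" for x
    using that by (simp add: I_def)
  have R: "R \<subseteq> D \<times> D"
    using AD CD self unfolding R_def by blast
  have "{y \<in> D. (x, y) \<in> R} \<in> Q" if "x \<in> A" for x
  proof -
    have "(\<Inter>z\<in>I (f x). C z) \<in> Q"
      using fin self[OF that] C by (intro inter_closed_INT[OF cl]) (auto simp: I_def)
    moreover have "{y \<in> D. (x, y) \<in> R} = (\<Inter>z\<in>I (f x). C z)"
      using that self[OF that] CD[OF that] by (auto simp: R_def)
    ultimately show ?thesis by simp
  qed
  then have "{x \<in> D. {y \<in> D. (x, y) \<in> R} \<in> Q} \<in> P"
    using AD by (intro proper_monotone_mono[OF P A]) auto
  then have "R\<inverse> \<in> iteration D Q P"
    using dom R by (auto simp: dominates_on_def iteration_def)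
  then have cols: "{y \<in> D. {x \<in> D. (x, y) \<in> R} \<in> P} \<in> Q"
    by (simp add: iteration_def)
  have "y \<in> (\<Inter>x\<in>A. C x)" if "{x \<in> D. (x, y) \<in> R} \<in> P" for y
  proof (rule ccontr)
    assume "y \<notin> (\<Inter>x\<in>A. C x)"
    then obtain z where z: "z \<in> A" "y \<notin> C z" by blast
    \<comment> \<open>From stage \<open>f z\<close> on, \<open>y\<close> has left the partial intersections, so its column is finite.\<close>
    have "{x \<in> D. (x, y) \<in> R} \<subseteq> I (f z)"
      using z by (fastforce simp: R_def I_def)
    moreover have "I (f z) \<subseteq> A"
      by (auto simp: I_def)
    ultimately show False
      using no_fin that fin finite_subset by (metis subset_trans)
  qed
  moreover have "(\<Inter>x\<in>A. C x) \<subseteq> D"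
    using A_ne CD by blast
  ultimately show ?thesis
    by (intro proper_monotone_mono[OF Q cols]) auto
qed

lemma iteration_eq_branching_if_inter_closed:
  assumes P: "proper_monotone D P" and Q: "proper_monotone D Q" and dom: "dominates_on D P Q"
    and "countable D" and cl: "inter_closed Q"
  shows "iteration D P Q = branching D P Q"
proof
  show "branching D P Q \<subseteq> iteration D P Q"
    using P Q by (rule branching_subset_iteration)
  show "iteration D P Q \<subseteq> branching D P Q"
  proof
    fix R assume "R \<in> iteration D P Q"
    define C where "C x = {y \<in> D. (x, y) \<in> R}" for x
    define A where "A = {x \<in> D. C x \<in> Q}"
    have R: "R \<subseteq> D \<times> D" and A: "A \<in> P"
      using \<open>R \<in> iteration D P Q\<close> by (auto simp: iteration_def A_def C_def)
    have C: "C x \<in> Q" if "x \<in> A" for x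
      using that by (simp add: A_def)
    obtain A' where A': "A' \<in> P" "(\<Inter>x\<in>A'. C x) \<in> Q"
    proof (cases "\<exists>F\<subseteq>A. finite F \<and> F \<in> P")
      case True
      then obtain F where F: "F \<subseteq> A" "finite F" "F \<in> P" by blast
      moreover have "F \<noteq> {}"
        using F P proper_monotone_empty by blast
      ultimately show ?thesis
        using C that inter_closed_INT[OF cl, of F C] by blast
    next
      case False
      then have "(\<Inter>x\<in>A. C x) \<in> Q"
        using C by (intro dominates_imp_INT[OF P Q dom \<open>countable D\<close> cl A]) auto
      with A show ?thesis by (rule that)
    qed
    moreover have "A' \<times> (\<Inter>x\<in>A'. C x) \<subseteq> R"
      by (auto simp: C_def)
    ultimately show "R \<in> branching D P Q"
      using R unfolding branching_def by blast
  qed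
qed

theorem theorem6p1:
  fixes D :: "'a set" and P Q :: "'a set set"
  assumes "D \<noteq> {}" and "countable D"
    and "quantifier_on D P" and "upward_monotone_on D P" and "proper_on D P"
    and "quantifier_on D Q" and "upward_monotone_on D Q" and "proper_on D Q"
  shows "dominates_on D P Q \<longleftrightarrow>
    iteration D P Q = branching D P Q \<or>
    iteration D (dual_on D Q) (dual_on D P) = branching D (dual_on D Q) (dual_on D P)"
proof -
  have P: "proper_monotone D P" and Q: "proper_monotone D Q"
    using assms by (auto simp: proper_monotone_def)
  note Pd = proper_monotone_dual[OF P] and Qd = proper_monotone_dual[OF Q]
  note dual_iff = dominates_dual_iff[OF \<open>quantifier_on D P\<close> \<open>quantifier_on D Q\<close>]
  show ?thesis
  proof
    assume dom: "dominates_on D P Q"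
    then have domd: "dominates_on D (dual_on D Q) (dual_on D P)"
      using dual_iff by blast
    from dominates_imp_inter_closed[OF P Q dom]
    show "iteration D P Q = branching D P Q \<or>
      iteration D (dual_on D Q) (dual_on D P) = branching D (dual_on D Q) (dual_on D P)"
      using iteration_eq_branching_if_inter_closed[OF P Q dom \<open>countable D\<close>]
        iteration_eq_branching_if_inter_closed[OF Qd Pd domd \<open>countable D\<close>]
      by blast
  next
    assume "iteration D P Q = branching D P Q \<or>
      iteration D (dual_on D Q) (dual_on D P) = branching D (dual_on D Q) (dual_on D P)"
    then show "dominates_on D P Q"
      using dominates_if_iteration_eq_branching[OF P Q]
        dominates_if_iteration_eq_branching[OF Qd Pd] dual_iff
      by blast
  qed
qed

end
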